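(* Let $r>1$ and let $S$ be an act over the free monoid $W_r$ generated by a finite set $A$, with growth function $g=g_{A,S}$. Write $g(n)=\alpha(n)r^n$ for a real-valued function $\alpha(n)$. Then $\alpha(n)$ converges to a finite limit $C_0$ as $n\to\infty$, and the growth of $S$ is maximal if and only if $C_0>0$. The same claim holds for the growth function of a finitely generated right module $M$ (with respect to a finite generating set $A$) over the free associative algebra $\mathcal{A}_r$ of rank $r>1$ over a field $\Phi$: writing $g_{A,M}(n)=\alpha(n)r^n$, the function $\alpha(n)$ converges to a finite limit $C_0$, and the growth of $M$ is maximal if and only if $C_0>0$.
   Context: $W_r$ is the free monoid on a set $X$ with $r$ elements ($r$ finite), and $\mathcal{A}_r=\Phi\langle X\rangle$ is the free associative algebra with $1$ over a field $\Phi$ with free generating set $X$. Acts are right acts (a set $S$ with a map $S\times W_r\to S$ such that $s(xy)=(sx)y$, $s1=s$), modules are right unital modules. $W(n)$ denotes the set of words in $X$ of length at most $n$, and $\mathcal{A}(n)$ is the linear span of $W(n)$ in $\mathcal{A}_r$. For an act $S$ with finite generating set $A$ the growth function is $g_{A,S}(n)=\#(A\,W(n))$; for a module $M$ with finite generating set $A$ it is $g_{A,M}(n)=\dim_\Phi (A\,\mathcal{A}(n))$, where $A\,\mathcal{A}(n)$ is the span of all $av$, $a\in A$, $v\in\mathcal{A}(n)$. Two nondecreasing functions $f,g$ on $\{0,1,2,\dots\}$ are equivalent if there are nonnegative integers $C,C'$ with $f(n)\le g(n+C)$ and $g(n)\le f(n+C')$ for all $n\ge 0$. The equivalence class of the growth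 function does not depend on the finite generating set and is called the growth. The growth of a finitely generated act (module) is called maximal if it equals the growth of the free act (module) of rank 1, i.e. the growth function is equivalent to $r^n$. *)

theory Defs
  imports Complex_Main "HOL-Library.Poly_Mapping" "HOL-Library.Cardinality"
begin

text \<open>The free monoid on the alphabet \<open>'x\<close>. It is written additively because the convolution
  product on \<open>\<Rightarrow>\<^sub>0\<close> is induced by the addition of the index type: \<open>u + v\<close> is the concatenation
  \<open>uv\<close> and \<open>0\<close> is the empty word.\<close>

datatype 'x free_monoid = Word (letters: "'x list")

instantiation free_monoid :: (type) monoid_add
begin

definition zero_free_monoid :: "'a free_monoid" where
  "zero_free_monoid = Word []"

definition plus_free_monoid :: "'a free_monoid \<Rightarrow> 'a free_monoid \<Rightarrow> 'a free_monoid" where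
  "plus_free_monoid u v = Word (letters u @ letters v)"

instance
  by standard (simp_all add: zero_free_monoid_def plus_free_monoid_def)

end

definition words_upto :: "nat \<Rightarrow> 'x free_monoid set" where
  "words_upto n = {w. length (letters w) \<le> n}"

text \<open>The free associative algebra with \<open>1\<close> is the monoid algebra of the free monoid; the word
  \<open>w\<close> is the element \<open>Poly_Mapping.single w 1\<close>.\<close>

type_synonym ('x, 'k) free_algebra = "'x free_monoid \<Rightarrow>\<^sub>0 'k"

definition growth_equiv :: "(nat \<Rightarrow> nat) \<Rightarrow> (nat \<Rightarrow> nat) \<Rightarrow> bool" where
  "growth_equiv f g \<longleftrightarrow> (\<exists>C C'. \<forall>n. f n \<le> g (n + C) \<and> g n \<le> f (n + C'))"

locale right_act =
  fixes S :: "'s set" and act :: "'s \<Rightarrow> 'x free_monoid \<Rightarrow> 's"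
  assumes act_closed: "s \<in> S \<Longrightarrow> act s w \<in> S"
    and act_mult: "s \<in> S \<Longrightarrow> act s (u + v) = act (act s u) v"
    and act_one: "s \<in> S \<Longrightarrow> act s 0 = s"
begin

definition generates :: "'s set \<Rightarrow> bool" where
  "generates A \<longleftrightarrow> A \<subseteq> S \<and> {act a w |a w. a \<in> A} = S"

definition growth_fun :: "'s set \<Rightarrow> nat \<Rightarrow> nat" where
  "growth_fun A n = card {act a w |a w. a \<in> A \<and> w \<in> words_upto n}"

text \<open>The growth is the equivalence class of the growth functions; the union over all finite
  generating sets avoids a choice.\<close>

definition growth :: "(nat \<Rightarrow> nat) set" where
  "growth = {f. mono f \<and> (\<exists>A. finite A \<and> generates A \<and> growth_equiv f (growth_fun A))}"

end

interpretation free_act: right_act UNIV "(+) :: 'x free_monoid \<Rightarrow> _"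
  by standard (simp_all add: add.assoc)

definition (in right_act) maximal_growth :: bool where
  "maximal_growth \<longleftrightarrow> growth = right_act.growth UNIV ((+) :: 'x free_monoid \<Rightarrow> _)"

locale right_module =
  fixes act :: "'m::ab_group_add \<Rightarrow> ('x, 'k::field) free_algebra \<Rightarrow> 'm"
  assumes act_add_left: "act (m + m') a = act m a + act m' a"
    and act_add_right: "act m (a + b) = act m a + act m b"
    and act_mult: "act m (a * b) = act (act m a) b"
    and act_one: "act m 1 = m"
begin

definition scale :: "'k \<Rightarrow> 'm \<Rightarrow> 'm" where
  "scale c m = act m (Poly_Mapping.single 0 c)"

sublocale vs: vector_space scale
proof
  fix a b :: 'k and x y :: 'm
  show "scale a (x + y) = scale a x + scale a y"
    by (simp add: scale_def act_add_left)
  show "scale (a + b) x = scale a x + scale b x"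
    by (simp add: scale_def single_add act_add_right)
  show "scale a (scale b x) = scale (a * b) x"
    by (simp add: scale_def mult_single mult.commute flip: act_mult)
  show "scale 1 x = x"
    by (simp add: scale_def act_one)
qed

text \<open>Closure under negation follows from the action of \<open>-1\<close>.\<close>

definition submodule :: "'m set \<Rightarrow> bool" where
  "submodule N \<longleftrightarrow> 0 \<in> N \<and> (\<forall>m\<in>N. \<forall>m'\<in>N. m + m' \<in> N) \<and> (\<forall>m\<in>N. \<forall>a. act m a \<in> N)"

definition generates :: "'m set \<Rightarrow> bool" where
  "generates A \<longleftrightarrow> submodule hull A = UNIV"

end

interpretation free_module: right_module "(*) :: ('x, 'k::field) free_algebra \<Rightarrow> _"
  by standard (simp_all add: algebra_simps)

definition algebra_upto :: "nat \<Rightarrow> ('x, 'k::field) free_algebra set" where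
  "algebra_upto n = free_module.vs.span ((\<lambda>w. Poly_Mapping.single w 1) ` words_upto n)"

context right_module
begin

definition growth_fun :: "'m set \<Rightarrow> nat \<Rightarrow> nat" where
  "growth_fun A n = vs.dim (vs.span {act a v |a v. a \<in> A \<and> v \<in> algebra_upto n})"

definition growth :: "(nat \<Rightarrow> nat) set" where
  "growth = {f. mono f \<and> (\<exists>A. finite A \<and> generates A \<and> growth_equiv f (growth_fun A))}"

definition maximal_growth :: bool where
  "maximal_growth \<longleftrightarrow>
    growth = right_module.growth ((*) :: ('x, 'k) free_algebra \<Rightarrow> _)"

end

end

theory Submission
  imports Defs
begin

text \<open>A word of length at most \<open>n + 1\<close> is empty or a word of length at most \<open>n\<close> followed by a
  letter, so \<open>g(n + 1) \<le> r g(n) + |A|\<close>, for cardinalities and for dimensions alike. Since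
  \<open>r \<ge> 2\<close>, the sequence \<open>\<alpha>(n) + |A| / r\<^sup>n\<close> is therefore nonincreasing; it is nonnegative, and so \<open>\<alpha>\<close> converges and is bounded. Boundedness
  gives \<open>g(n) \<le> r\<^bsup>n+C\<^esup>\<close>, while \<open>r\<^sup>n \<le> g(n + C)\<close> for some \<open>C\<close> says that \<open>\<alpha>\<close> stays away from \<open>0\<close>.
  The growth of the free object is the class of \<open>r\<^sup>n\<close>, and the class of \<open>g\<close> does not depend on \<open>A\<close>.\<close>

section \<open>Equivalence of growth functions and their classes\<close>

lemma growth_equiv_sym: "growth_equiv f g \<Longrightarrow> growth_equiv g f"
  unfolding growth_equiv_def by blast

lemma growth_equiv_trans:
  assumes "growth_equiv f g" and "growth_equiv g h"
  shows "growth_equiv f h"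
proof -
  obtain C C' where 1: "\<And>n. f n \<le> g (n + C)" "\<And>n. g n \<le> f (n + C')"
    using assms(1) unfolding growth_equiv_def by blast
  obtain D D' where 2: "\<And>n. g n \<le> h (n + D)" "\<And>n. h n \<le> g (n + D')"
    using assms(2) unfolding growth_equiv_def by blast
  have "f n \<le> h (n + (C + D))" "h n \<le> f (n + (D' + C'))" for n
    using 1(1)[of n] 2(1)[of "n + C"] 2(2)[of n] 1(2)[of "n + D'"]
    by (simp_all add: add.assoc)
  then show ?thesis
    unfolding growth_equiv_def by blast
qed

lemma growth_class_cong:
  assumes "growth_equiv f g"
  shows "{h. mono h \<and> growth_equiv h f} = {h. mono h \<and> growth_equiv h g}"
  using growth_equiv_trans[OF _ assms] growth_equiv_trans[OF _ growth_equiv_sym[OF assms]]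
  by (intro Collect_cong conj_cong refl iffI)

text \<open>Monotonicity and reflexivity place \<open>f\<close> in its own class, so equal classes
  force \<open>f\<close> to lie in the class of \<open>g\<close>. This turns maximality, an equality
  of classes, into one equivalence of functions.\<close>

lemma growth_class_eq_iff:
  assumes "mono f" and "mono g"
  shows "{h. mono h \<and> growth_equiv h f} = {h. mono h \<and> growth_equiv h g} \<longleftrightarrow> growth_equiv f g"
proof
  have "growth_equiv f f"
    unfolding growth_equiv_def by (metis add_0_right order_refl)
  moreover assume "{h. mono h \<and> growth_equiv h f} = {h. mono h \<and> growth_equiv h g}"
  ultimately show "growth_equiv f g"
    using assms by blast
qed (rule growth_class_cong)

section \<open>The limit of the growth coefficient\<close>

lemma growth_coefficient_limit:
  fixes g :: "nat \<Rightarrow> nat" and r c :: nat and \<alpha> :: "nat \<Rightarrow> real"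
  assumes r: "r > 1" and rec: "\<And>n. g (Suc n) \<le> r * g n + c"
    and \<alpha>: "\<And>n. real (g n) = \<alpha> n * real r ^ n"
  obtains C\<^sub>0 where "\<alpha> \<longlonglongrightarrow> C\<^sub>0" and "growth_equiv g (\<lambda>n. r ^ n) \<longleftrightarrow> C\<^sub>0 > 0"
proof -
  have pos: "real r ^ n > 0" for n
    using r by simp
  have \<alpha>_eq: "\<alpha> n = real (g n) / real r ^ n" for n
    using \<alpha>[of n] pos[of n] by (simp add: field_simps)
  define \<gamma> where "\<gamma> n = \<alpha> n + real c / real r ^ n" for n
  have "\<gamma> (Suc n) \<le> \<gamma> n" for n
  proof -
    have "real (g (Suc n)) + real c \<le> real r * real (g n) + 2 * real c"
      using of_nat_mono[OF rec[of n], where 'a = real] by simp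
    \<comment> \<open>One \<open>c\<close> comes from the recursion and one from the correction term
      in \<gamma>; \<open>r\<close> at least 2 absorbs both into \<open>r * c\<close>.\<close>
    also have "\<dots> \<le> real r * (real (g n) + real c)"
      using r mult_right_mono[of 2 "real r" "real c"] by (simp add: algebra_simps)
    finally have "(real (g (Suc n)) + real c) / real r ^ Suc n
        \<le> real r * (real (g n) + real c) / real r ^ Suc n"
      using pos[of "Suc n"] by (intro divide_right_mono) auto
    then show ?thesis
      using r by (simp add: \<gamma>_def \<alpha>_eq add_divide_distrib)
  qed
  then have dec: "decseq \<gamma>"
    by (rule decseq_SucI)
  have "\<gamma> n \<ge> 0" for n
    unfolding \<gamma>_def \<alpha>_eq by simp
  then obtain C\<^sub>0 where C\<^sub>0: "\<gamma> \<longlonglongrightarrow> C\<^sub>0"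
    using decseq_convergent[OF dec] by blast
  have "(\<lambda>n. real c / real r ^ n) \<longlonglongrightarrow> 0"
    using tendsto_mult_right_zero[OF LIMSEQ_inverse_realpow_zero[of "real r"], of "real c"] r
    by (simp add: divide_inverse)
  from tendsto_diff[OF C\<^sub>0 this] have lim: "\<alpha> \<longlonglongrightarrow> C\<^sub>0"
    by (simp add: \<gamma>_def)
  have upper: "\<exists>C. \<forall>n. g n \<le> r ^ (n + C)"
  proof -
    \<comment> \<open>The chain \<alpha> n \<le> \<gamma> n \<le> \<gamma> 0 bounds the coefficient
      by a constant; majorised by a power of \<open>r\<close>, that constant becomes a shift of the
      argument.\<close>
    obtain C where C: "\<gamma> 0 < real r ^ C"
      using real_arch_pow[of "real r"] r by auto
    have "\<alpha> n \<le> real r ^ C" for n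
      using decseqD[OF dec, of 0 n] C
      by (simp add: \<gamma>_def)
        (smt (verit) divide_nonneg_nonneg of_nat_0_le_iff zero_le_power)
    then have "real (g n) \<le> real (r ^ (n + C))" for n
      using mult_right_mono[of "\<alpha> n" "real r ^ C" "real r ^ n"] pos[of n] \<alpha>[of n]
      by (simp add: power_add mult.commute)
    then show ?thesis
      using of_nat_le_iff by blast
  qed
  have "growth_equiv g (\<lambda>n. r ^ n) \<longleftrightarrow> C\<^sub>0 > 0"
  proof
    assume "growth_equiv g (\<lambda>n. r ^ n)"
    then obtain C where C: "\<And>n. r ^ n \<le> g (n + C)"
      unfolding growth_equiv_def by blast
    \<comment> \<open>Dividing the lower estimate by the power with exponent \<open>n + C\<close>
      leaves a positive bound independent of \<open>n\<close>, which survives in the limit.\<close>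
    have "1 / real r ^ C \<le> \<alpha> (n + C)" for n
    proof -
      have "real r ^ n \<le> real (g (n + C))"
        using of_nat_mono[OF C[of n], where 'a = real] by simp
      then show ?thesis
        using pos[of n] pos[of C] by (simp add: \<alpha>_eq power_add field_simps)
    qed
    then have "1 / real r ^ C \<le> C\<^sub>0"
      using LIMSEQ_le_const[OF LIMSEQ_ignore_initial_segment[OF lim, of C]] by blast
    moreover have "1 / real r ^ C > 0"
      using pos[of C] by simp
    ultimately show "C\<^sub>0 > 0"
      by linarith
  next
    assume "C\<^sub>0 > 0"
    then have "\<forall>\<^sub>F n in sequentially. C\<^sub>0 / 2 < \<alpha> n"
      using order_tendstoD(1)[OF lim, of "C\<^sub>0 / 2"] by simp
    then obtain N where N: "\<And>n. n \<ge> N \<Longrightarrow> C\<^sub>0 / 2 < \<alpha> n"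
      unfolding eventually_sequentially by blast
    \<comment> \<open>A shift by \<open>N\<close> reaches the range where \<alpha> exceeds half its
      limit; a further shift by \<open>K\<close> gains a power of \<open>r\<close> that compensates
      this factor.\<close>
    obtain K where K: "2 / C\<^sub>0 < real r ^ K"
      using real_arch_pow[of "real r"] r by auto
    have "r ^ n \<le> g (n + (N + K))" for n
    proof -
      have "1 \<le> C\<^sub>0 / 2 * real r ^ K"
        using K \<open>C\<^sub>0 > 0\<close> by (simp add: field_simps)
      also have "\<dots> \<le> \<alpha> (n + (N + K)) * real r ^ (N + K)"
        using N[of "n + (N + K)"] \<open>C\<^sub>0 > 0\<close> r by (intro mult_mono power_increasing) auto
      finally have "real r ^ n * 1 \<le> real r ^ n * (\<alpha> (n + (N + K)) * real r ^ (N + K))"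
        using pos[of n] by (intro mult_left_mono) auto
      also have "\<dots> = real (g (n + (N + K)))"
        unfolding \<alpha> by (simp add: power_add mult_ac)
      finally show ?thesis
        by (simp flip: of_nat_power)
    qed
    then show "growth_equiv g (\<lambda>n. r ^ n)"
      using upper unfolding growth_equiv_def by blast
  qed
  with lim show thesis
    by (rule that)
qed

section \<open>Words of bounded length\<close>

lemma words_upto_mono: "m \<le> n \<Longrightarrow> words_upto m \<subseteq> words_upto n"
  unfolding words_upto_def by auto

lemma words_upto_0: "words_upto 0 = {0}"
  by (auto simp: words_upto_def zero_free_monoid_def free_monoid.expand)

lemma add_in_words_upto: "u \<in> words_upto m \<Longrightarrow> v \<in> words_upto n \<Longrightarrow> u + v \<in> words_upto (m + n)"
  by (auto simp: words_upto_def plus_free_monoid_def)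

text \<open>The last letter is split off, not the first: under a right action the prefix acts first,
  so an element of level \<open>n + 1\<close> arises from one of level \<open>n\<close> by a single
  letter.\<close>

lemma words_upto_Suc:
  "words_upto (Suc n) = insert 0 ((\<lambda>(u, x). u + Word [x]) ` (words_upto n \<times> UNIV))"
proof (intro equalityI subsetI)
  fix w :: "'a free_monoid"
  assume w: "w \<in> words_upto (Suc n)"
  show "w \<in> insert 0 ((\<lambda>(u, x). u + Word [x]) ` (words_upto n \<times> UNIV))"
  proof (cases "letters w" rule: rev_cases)
    case Nil
    then show ?thesis
      by (simp add: zero_free_monoid_def free_monoid.expand)
  next
    case (snoc xs x)
    then have "w = Word xs + Word [x]" "Word xs \<in> words_upto n"
      using w by (auto simp: words_upto_def plus_free_monoid_def free_monoid.expand)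
    then show ?thesis
      by force
  qed
qed (auto simp: words_upto_def zero_free_monoid_def plus_free_monoid_def)

lemma finite_words_upto: "finite (words_upto n :: 'x::finite free_monoid set)"
  by (induction n) (simp_all add: words_upto_0 words_upto_Suc)

lemma power_card_le_card_words_upto: "CARD('x) ^ n \<le> card (words_upto n :: 'x::finite free_monoid set)"
proof -
  have "CARD('x) ^ n = card {xs :: 'x list. length xs = n}"
    using card_lists_length_eq[of "UNIV :: 'x set" n] by simp
  also have "\<dots> = card (Word ` {xs :: 'x list. length xs = n})"
    by (rule card_image[symmetric]) (simp add: inj_on_def)
  also have "\<dots> \<le> card (words_upto n :: 'x free_monoid set)"
    by (rule card_mono[OF finite_words_upto]) (auto simp: words_upto_def)
  finally show ?thesis .
qed

text \<open>The lower bound keeps the coefficient at least 1, so its limit is positive. This serves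
  the free objects of rank 1, where distinct words give distinct or independent elements.\<close>

lemma growth_equiv_powerI:
  assumes "r > 1" and "\<And>n. g (Suc n) \<le> r * g n + c" and lower: "\<And>n. r ^ n \<le> g n"
  shows "growth_equiv g (\<lambda>n. r ^ n)"
proof -
  have "real (g n) = (real (g n) / real r ^ n) * real r ^ n" for n
    using \<open>r > 1\<close> by simp
  from growth_coefficient_limit[OF assms(1,2) this]
  obtain C\<^sub>0 where lim: "(\<lambda>n. real (g n) / real r ^ n) \<longlonglongrightarrow> C\<^sub>0"
    and iff: "growth_equiv g (\<lambda>n. r ^ n) \<longleftrightarrow> C\<^sub>0 > 0"
    by blast
  have "1 \<le> real (g n) / real r ^ n" for n
    using of_nat_mono[OF lower[of n], where 'a = real] \<open>r > 1\<close> by (simp add: field_simps)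
  then have "1 \<le> C\<^sub>0"
    using LIMSEQ_le_const[OF lim] by blast
  with iff show ?thesis
    by simp
qed

lemma mono_power_nat: "r > 1 \<Longrightarrow> mono (\<lambda>n. r ^ n :: nat)"
  by (simp add: monoI power_increasing)

section \<open>Growth of acts over the free monoid\<close>

locale finite_alphabet_act = right_act S act
  for S :: "'s set" and act :: "'s \<Rightarrow> 'x::finite free_monoid \<Rightarrow> 's"
begin

lemma finite_orbit: "finite A \<Longrightarrow> finite {act a w |a w. a \<in> A \<and> w \<in> words_upto n}"
  by (rule finite_image_set2) (simp_all add: finite_words_upto)

lemma growth_fun_mono: "finite A \<Longrightarrow> mono (growth_fun A)"
  unfolding growth_fun_def
  by (intro monoI card_mono finite_orbit) (use words_upto_mono in blast)+

text \<open>Level \<open>n + 1\<close> consists of images of level \<open>n\<close> under the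
  letters, together with the generators themselves, which come from the empty word.\<close>

lemma growth_fun_Suc:
  assumes A: "finite A" "A \<subseteq> S"
  shows "growth_fun A (Suc n) \<le> CARD('x) * growth_fun A n + card A"
proof -
  let ?O = "\<lambda>n. {act a w |a w. a \<in> A \<and> w \<in> words_upto n}"
  let ?L = "(\<lambda>(s, x). act s (Word [x])) ` (?O n \<times> UNIV)"
  have "?O (Suc n) \<subseteq> ?L \<union> A"
  proof (rule subsetI)
    fix s assume "s \<in> ?O (Suc n)"
    then obtain a w where s: "a \<in> A" "s = act a w" "w \<in> words_upto (Suc n)"
      by blast
    then consider "w = 0" | u x where "u \<in> words_upto n" "w = u + Word [x]"
      unfolding words_upto_Suc by auto
    then show "s \<in> ?L \<union> A"
    proof cases
      case 1
      then show ?thesis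
        using s A by (auto simp: act_one)
    next
      case 2
      then have "s = act (act a u) (Word [x])" "act a u \<in> ?O n"
        using s A by (auto simp: act_mult)
      then show ?thesis
        by (intro UnI1 image_eqI[where x = "(act a u, x)"]) auto
    qed
  qed
  then have "card (?O (Suc n)) \<le> card (?L \<union> A)"
    by (rule card_mono[rotated]) (use A finite_orbit[OF A(1)] in simp)
  also have "\<dots> \<le> card ?L + card A"
    by (rule card_Un_le)
  also have "card ?L \<le> card (?O n \<times> (UNIV :: 'x set))"
    by (rule card_image_le) (use finite_orbit[OF A(1)] in simp)
  finally show ?thesis
    by (simp add: growth_fun_def card_cartesian_product mult.commute)
qed

text \<open>Each element of \<open>B\<close> is reached from \<open>A\<close> by some word; the
  longest of these finitely many words gives the shift.\<close>

lemma growth_fun_le_shift: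
  assumes "finite A" "finite B" and gen: "generates A" "generates B"
  shows "\<exists>C. \<forall>n. growth_fun B n \<le> growth_fun A (n + C)"
proof -
  have "\<exists>a w. a \<in> A \<and> b = act a w" if "b \<in> B" for b
    using that gen unfolding generates_def by blast
  then obtain a w where aw: "\<And>b. b \<in> B \<Longrightarrow> a b \<in> A \<and> b = act (a b) (w b)"
    by metis
  \<comment> \<open>The inserted 0 covers an empty \<open>B\<close>, where \<open>Max\<close> would
    have no specified value.\<close>
  define C where "C = Max (insert 0 ((\<lambda>b. length (letters (w b))) ` B))"
  have w: "w b \<in> words_upto C" if "b \<in> B" for b
    using that \<open>finite B\<close> by (auto simp: words_upto_def C_def intro: Max_ge)
  have sub: "{act b u |b u. b \<in> B \<and> u \<in> words_upto n}
      \<subseteq> {act a u |a u. a \<in> A \<and> u \<in> words_upto (n + C)}" for n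
  proof clarify
    fix b and u :: "'x free_monoid"
    assume b: "b \<in> B" and u: "u \<in> words_upto n"
    have "act b u = act (a b) (w b + u)"
      using aw[OF b] gen unfolding generates_def by (metis act_mult subsetD)
    moreover have "w b + u \<in> words_upto (n + C)"
      using add_in_words_upto[OF w[OF b] u] by (simp add: add.commute)
    ultimately show "\<exists>a' u'. act b u = act a' u' \<and> a' \<in> A \<and> u' \<in> words_upto (n + C)"
      using aw[OF b] by (intro exI conjI) auto
  qed
  show ?thesis
    unfolding growth_fun_def by (intro exI[of _ C] allI card_mono[OF finite_orbit[OF \<open>finite A\<close>]] sub)
qed

text \<open>Shifts in both directions make the growth functions of any two finite generating sets
  equivalent, so the union over all such sets collapses to one class.\<close>

lemma growth_eq:
  assumes "finite A" and "generates A"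
  shows "growth = {f. mono f \<and> growth_equiv f (growth_fun A)}"
proof -
  have equiv: "growth_equiv (growth_fun B) (growth_fun A)" if "finite B" "generates B" for B
  proof -
    obtain C C' where "\<forall>n. growth_fun B n \<le> growth_fun A (n + C)"
      and "\<forall>n. growth_fun A n \<le> growth_fun B (n + C')"
      using growth_fun_le_shift[OF assms(1) \<open>finite B\<close>] growth_fun_le_shift[OF \<open>finite B\<close> assms(1)]
        assms(2) \<open>generates B\<close> by metis
    then show ?thesis
      unfolding growth_equiv_def by blast
  qed
  have "(\<exists>B. finite B \<and> generates B \<and> growth_equiv f (growth_fun B))
      \<longleftrightarrow> growth_equiv f (growth_fun A)" for f
  proof
    assume "\<exists>B. finite B \<and> generates B \<and> growth_equiv f (growth_fun B)"
    then obtain B where "finite B" "generates B" "growth_equiv f (growth_fun B)"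
      by blast
    then show "growth_equiv f (growth_fun A)"
      using growth_equiv_trans[OF _ equiv] by blast
  qed (use assms in blast)
  then show ?thesis
    unfolding growth_def by simp
qed

end

text \<open>The empty word generates the free act, and its growth function counts the words of
  length at most \<open>n\<close>.\<close>

lemma free_act_growth:
  assumes "CARD('x::finite) > 1"
  shows "right_act.growth UNIV ((+) :: 'x free_monoid \<Rightarrow> _) =
    {f. mono f \<and> growth_equiv f (\<lambda>n. CARD('x) ^ n)}"
proof -
  interpret free: finite_alphabet_act UNIV "(+) :: 'x free_monoid \<Rightarrow> _"
    by (rule finite_alphabet_act.intro[OF free_act.right_act_axioms])
  have gen: "free_act.generates {0 :: 'x free_monoid}"
    unfolding free_act.generates_def by auto
  have eq: "free_act.growth_fun {0 :: 'x free_monoid} n = card (words_upto n :: 'x free_monoid set)" for n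
    unfolding free_act.growth_fun_def by simp
  have "growth_equiv (free_act.growth_fun {0 :: 'x free_monoid}) (\<lambda>n. CARD('x) ^ n)"
    by (rule growth_equiv_powerI[OF assms, where c = "card {0 :: 'x free_monoid}"])
      (use free.growth_fun_Suc[of "{0 :: 'x free_monoid}"] in \<open>simp_all add: eq power_card_le_card_words_upto\<close>)
  then show ?thesis
    unfolding free.growth_eq[OF _ gen, simplified]
    by (rule growth_class_cong)
qed

lemma (in finite_alphabet_act) maximal_growth_iff:
  assumes "CARD('x) > 1" and "finite A" and "generates A"
  shows "maximal_growth \<longleftrightarrow> growth_equiv (growth_fun A) (\<lambda>n. CARD('x) ^ n)"
  unfolding maximal_growth_def free_act_growth[OF assms(1)] growth_eq[OF assms(2,3)]
  by (rule growth_class_eq_iff[OF growth_fun_mono[OF assms(2)] mono_power_nat[OF assms(1)]])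

section \<open>Growth of modules over the free associative algebra\<close>

lemma poly_mapping_add_induct [case_names zero single add]:
  assumes "P 0" and "\<And>k c. P (Poly_Mapping.single k c)" and "\<And>a b. P a \<Longrightarrow> P b \<Longrightarrow> P (a + b)"
  shows "P (p :: 'a \<Rightarrow>\<^sub>0 'b::comm_monoid_add)"
proof -
  \<comment> \<open>The index set \<open>K\<close> varies while \<open>p\<close> stays fixed, so
    that the induction runs over finite sets; \<open>K\<close> is then taken to be the support of
    \<open>p\<close>.\<close>
  have "P (\<Sum>k\<in>K. Poly_Mapping.single k (Poly_Mapping.lookup p k))" if "finite K" for K
    using that by induction (auto intro: assms)
  moreover have "p = (\<Sum>k\<in>Poly_Mapping.keys p. Poly_Mapping.single k (Poly_Mapping.lookup p k))"
    by (rule poly_mapping_eqI)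
      (auto simp: lookup_sum lookup_single when_def in_keys_iff)
  ultimately show ?thesis
    by (metis finite_keys)
qed

locale finite_alphabet_module = right_module act
  for act :: "'m::ab_group_add \<Rightarrow> ('x::finite, 'k::field) free_algebra \<Rightarrow> 'm"
begin

definition word_act :: "'m \<Rightarrow> 'x free_monoid \<Rightarrow> 'm" where
  "word_act m w = act m (Poly_Mapping.single w 1)"

lemma word_act_zero [simp]: "word_act m 0 = m"
  by (simp add: word_act_def act_one)

lemma word_act_add: "word_act m (u + v) = word_act (word_act m u) v"
  by (simp add: word_act_def mult_single flip: act_mult)

lemma act_single: "act m (Poly_Mapping.single w c) = scale c (word_act m w)"
  by (simp add: word_act_def scale_def mult_single flip: act_mult)

lemma act_zero [simp]: "act m 0 = 0"
  using act_add_right[of m 0 0] by simp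

text \<open>Linearity lets the action of a word commute with taking spans, so estimates need only be
  checked on spanning sets.\<close>

lemma word_act_linear: "module_hom scale scale (\<lambda>m. word_act m w)"
proof unfold_locales
  show "word_act (m + m') w = word_act m w + word_act m' w" for m m'
    by (simp add: word_act_def act_add_left)
  show "word_act (scale c m) w = scale c (word_act m w)" for c m
    by (simp add: word_act_def scale_def mult_single flip: act_mult)
qed

text \<open>For finite \<open>A\<close> this is a finite set spanning the space whose dimension is
  the growth function. It plays the part of the orbit set of an act.\<close>

definition layer :: "'m set \<Rightarrow> nat \<Rightarrow> 'm set" where
  "layer A n = {word_act a w |a w. a \<in> A \<and> w \<in> words_upto n}"

lemma finite_layer: "finite A \<Longrightarrow> finite (layer A n)"
  unfolding layer_def
  by (rule finite_image_set2) (simp_all add: finite_words_upto)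

lemma layer_mono: "m \<le> n \<Longrightarrow> layer A m \<subseteq> layer A n"
  unfolding layer_def using words_upto_mono by blast

lemma act_in_span_layer:
  assumes "a \<in> A" and "v \<in> algebra_upto n"
  shows "act a v \<in> vs.span (layer A n)"
  using assms(2) unfolding algebra_upto_def
proof (induction rule: free_module.vs.span_induct_alt)
  case (step c x y)
  then obtain w where w: "x = Poly_Mapping.single w 1" "w \<in> words_upto n"
    by blast
  have "act a (free_module.scale c x + y) = scale c (word_act a w) + act a y"
    by (simp add: w free_module.scale_def act_add_right mult_single act_single)
  moreover have "word_act a w \<in> vs.span (layer A n)"
    using w \<open>a \<in> A\<close> by (auto simp: layer_def intro!: vs.span_base)
  ultimately show ?case
    using step by (simp add: vs.span_add vs.span_scale)
qed (simp add: vs.span_zero)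

lemma growth_fun_eq_dim_layer: "growth_fun A n = vs.dim (layer A n)"
proof -
  have "vs.span {act a v |a v. a \<in> A \<and> v \<in> algebra_upto n} = vs.span (layer A n)"
  proof (rule vs.span_eq[THEN iffD2], intro conjI subsetI)
    fix m assume "m \<in> layer A n"
    then obtain a w where "a \<in> A" "w \<in> words_upto n" "m = act a (Poly_Mapping.single w 1)"
      by (auto simp: layer_def word_act_def)
    moreover from this have "Poly_Mapping.single w 1 \<in> algebra_upto n"
      unfolding algebra_upto_def by (intro free_module.vs.span_base) blast
    ultimately show "m \<in> vs.span {act a v |a v. a \<in> A \<and> v \<in> algebra_upto n}"
      by (intro vs.span_base) blast
  qed (use act_in_span_layer in blast)
  then show ?thesis
    by (simp add: growth_fun_def)
qed

lemma finite_basis_layer: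
  assumes "finite A"
  obtains D where "finite D" "layer A n \<subseteq> vs.span D" "card D = vs.dim (layer A n)"
proof -
  obtain D where D: "D \<subseteq> layer A n" "layer A n \<subseteq> vs.span D" "card D = vs.dim (layer A n)"
    by (rule vs.basis_exists)
  show thesis
    by (rule that[OF finite_subset[OF D(1) finite_layer[OF assms]] D(2,3)])
qed

text \<open>As \<open>vs.dim\<close> is a \<open>card\<close>, it is 0 in infinite dimension and not
  monotone in general. A finite basis of the layer supplies the bound here.\<close>

lemma dim_le_dim_layer:
  assumes "finite A" and "V \<subseteq> vs.span (layer A n)"
  shows "vs.dim V \<le> vs.dim (layer A n)"
proof -
  obtain D where "finite D" and D: "layer A n \<subseteq> vs.span D" "card D = vs.dim (layer A n)"
    using finite_basis_layer[OF assms(1)] by blast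
  have "V \<subseteq> vs.span D"
    using assms(2) vs.span_minimal[OF D(1) vs.subspace_span] by blast
  then show ?thesis
    using vs.dim_le_card \<open>finite D\<close> D(2) by metis
qed

lemma growth_fun_mono: "finite A \<Longrightarrow> mono (growth_fun A)"
  unfolding growth_fun_eq_dim_layer
  by (intro monoI dim_le_dim_layer subset_trans[OF layer_mono vs.span_superset])

lemma word_act_in_span_layer:
  assumes "m \<in> vs.span (layer A k)" and "w \<in> words_upto n"
  shows "word_act m w \<in> vs.span (layer A (k + n))"
proof -
  interpret word_hom: module_hom scale scale "\<lambda>m. word_act m w"
    by (rule word_act_linear)
  have "(\<lambda>m. word_act m w) ` layer A k \<subseteq> layer A (k + n)"
    using add_in_words_upto[OF _ assms(2)] by (fastforce simp: layer_def simp flip: word_act_add)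
  then have "vs.span ((\<lambda>m. word_act m w) ` layer A k) \<subseteq> vs.span (layer A (k + n))"
    by (rule vs.span_mono)
  then show ?thesis
    using assms(1) by (auto simp: word_hom.span_image)
qed

lemma growth_fun_Suc:
  assumes A: "finite A"
  shows "growth_fun A (Suc n) \<le> CARD('x) * growth_fun A n + card A"
proof -
  \<comment> \<open>Letters are applied to a basis of the layer rather than to the layer itself, so
    that the count is \<open>CARD('x)\<close> times the dimension, not the cardinality.\<close>
  obtain D where "finite D" and D: "layer A n \<subseteq> vs.span D" "card D = vs.dim (layer A n)"
    using finite_basis_layer[OF A] by blast
  let ?L = "(\<lambda>(m, x). word_act m (Word [x])) ` (D \<times> UNIV)"
  have "layer A (Suc n) \<subseteq> vs.span (?L \<union> A)"
  proof (rule subsetI)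
    fix m assume "m \<in> layer A (Suc n)"
    then obtain a w where m: "a \<in> A" "m = word_act a w" "w \<in> words_upto (Suc n)"
      by (auto simp: layer_def)
    then consider "w = 0" | u x where "u \<in> words_upto n" "w = u + Word [x]"
      unfolding words_upto_Suc by auto
    then show "m \<in> vs.span (?L \<union> A)"
    proof cases
      case 1
      then show ?thesis
        using m by (auto intro: vs.span_base)
    next
      case 2
      interpret word_hom: module_hom scale scale "\<lambda>m. word_act m (Word [x])"
        by (rule word_act_linear)
      have "word_act a u \<in> vs.span D"
        using D(1) 2 m by (auto simp: layer_def)
      then have "m \<in> vs.span ((\<lambda>m. word_act m (Word [x])) ` D)"
        by (simp add: m 2 word_act_add word_hom.span_image)
      also have "\<dots> \<subseteq> vs.span (?L \<union> A)"
        by (rule vs.span_mono) force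
      finally show ?thesis .
    qed
  qed
  then have "vs.dim (layer A (Suc n)) \<le> card (?L \<union> A)"
    by (rule vs.dim_le_card) (use A \<open>finite D\<close> in simp)
  also have "\<dots> \<le> card ?L + card A"
    by (rule card_Un_le)
  also have "card ?L \<le> card (D \<times> (UNIV :: 'x set))"
    by (rule card_image_le) (use \<open>finite D\<close> in simp)
  finally show ?thesis
    by (simp add: growth_fun_eq_dim_layer card_cartesian_product mult.commute D(2))
qed

lemma span_layer_mono: "m \<le> n \<Longrightarrow> vs.span (layer A m) \<subseteq> vs.span (layer A n)"
  by (intro vs.span_mono layer_mono)

text \<open>The spans form an increasing chain, so two elements have a common level, and an algebra
  element acts as a sum of monomials, each raising the level by its length. The generated submodule,
  defined as a hull, thereby becomes explicit.\<close>

lemma submodule_Union_layer: "submodule (\<Union>n. vs.span (layer A n))"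
proof -
  let ?U = "\<Union>n. vs.span (layer A n)"
  have sum_closed: "m + m' \<in> ?U" if m: "m \<in> ?U" "m' \<in> ?U" for m m'
  proof -
    obtain i j where "m \<in> vs.span (layer A i)" "m' \<in> vs.span (layer A j)"
      using m by blast
    then have "m \<in> vs.span (layer A (max i j))" "m' \<in> vs.span (layer A (max i j))"
      using span_layer_mono[of _ "max i j"] by (meson max.cobounded1 max.cobounded2 subsetD)+
    then show ?thesis
      using vs.span_add by blast
  qed
  have "act m a \<in> ?U" if m: "m \<in> ?U" for m a
  proof (induction a rule: poly_mapping_add_induct)
    case zero
    show ?case
      using vs.span_zero by auto
  next
    case (single w c)
    obtain k where "m \<in> vs.span (layer A k)"
      using m by blast
    moreover have "w \<in> words_upto (length (letters w))"
      by (simp add: words_upto_def)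
    ultimately have "act m (Poly_Mapping.single w c) \<in> vs.span (layer A (k + length (letters w)))"
      unfolding act_single by (intro vs.span_scale word_act_in_span_layer)
    then show ?case
      by blast
  next
    case (add a b)
    then show ?case
      unfolding act_add_right by (rule sum_closed)
  qed
  moreover have "0 \<in> ?U"
    using vs.span_zero by blast
  ultimately show ?thesis
    unfolding submodule_def using sum_closed by simp
qed

lemma Union_layer_eq_UNIV:
  assumes "generates A"
  shows "(\<Union>n. vs.span (layer A n)) = UNIV"
proof -
  have "A \<subseteq> layer A 0"
    by (force simp: layer_def words_upto_0)
  then have "A \<subseteq> (\<Union>n. vs.span (layer A n))"
    using vs.span_superset by blast
  then have "submodule hull A \<subseteq> (\<Union>n. vs.span (layer A n))"
    by (rule hull_minimal) (rule submodule_Union_layer)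
  then show ?thesis
    using assms by (auto simp: generates_def)
qed

lemma growth_fun_le_shift:
  assumes "finite A" "finite B" and gen: "generates A"
  shows "\<exists>C. \<forall>n. growth_fun B n \<le> growth_fun A (n + C)"
proof -
  have "\<exists>k. b \<in> vs.span (layer A k)" for b
    using Union_layer_eq_UNIV[OF gen] by blast
  \<comment> \<open>The level \<open>k b\<close> replaces the length of the word that reaches
    \<open>b\<close> in an act; the maximal level over \<open>B\<close> is the shift.\<close>
  then obtain k where k: "\<And>b. b \<in> vs.span (layer A (k b))"
    by metis
  define C where "C = Max (insert 0 (k ` B))"
  have B: "b \<in> vs.span (layer A C)" if "b \<in> B" for b
    using that \<open>finite B\<close> k[of b] span_layer_mono[of "k b" C A] by (auto simp: C_def intro: Max_ge)
  have sub: "layer B n \<subseteq> vs.span (layer A (n + C))" for n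
    using word_act_in_span_layer[OF B] by (auto simp: layer_def add.commute[of n])
  show ?thesis
    unfolding growth_fun_eq_dim_layer by (intro exI[of _ C] allI dim_le_dim_layer[OF \<open>finite A\<close>] sub)
qed

lemma growth_eq:
  assumes "finite A" and "generates A"
  shows "growth = {f. mono f \<and> growth_equiv f (growth_fun A)}"
proof -
  have equiv: "growth_equiv (growth_fun B) (growth_fun A)" if "finite B" "generates B" for B
  proof -
    obtain C C' where "\<forall>n. growth_fun B n \<le> growth_fun A (n + C)"
      and "\<forall>n. growth_fun A n \<le> growth_fun B (n + C')"
      using growth_fun_le_shift[OF assms(1) \<open>finite B\<close>] growth_fun_le_shift[OF \<open>finite B\<close> assms(1)]
        assms(2) \<open>generates B\<close> by metis
    then show ?thesis
      unfolding growth_equiv_def by blast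
  qed
  have "(\<exists>B. finite B \<and> generates B \<and> growth_equiv f (growth_fun B))
      \<longleftrightarrow> growth_equiv f (growth_fun A)" for f
  proof
    assume "\<exists>B. finite B \<and> generates B \<and> growth_equiv f (growth_fun B)"
    then obtain B where "finite B" "generates B" "growth_equiv f (growth_fun B)"
      by blast
    then show "growth_equiv f (growth_fun A)"
      using growth_equiv_trans[OF _ equiv] by blast
  qed (use assms in blast)
  then show ?thesis
    unfolding growth_def by simp
qed

end

section \<open>The free module of rank 1 and the two claims\<close>

lemma inj_single_one: "inj (\<lambda>k. Poly_Mapping.single k (1 :: 'b::zero_neq_one))"
  by (rule injI) (metis lookup_single_eq lookup_single_not_eq zero_neq_one)

lemma independent_words:
  "free_module.vs.independent
    ((\<lambda>w. Poly_Mapping.single w 1 :: ('x, 'k::field) free_algebra) ` W)"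
  unfolding free_module.vs.independent_explicit_module
proof (intro allI impI)
  fix T :: "('x, 'k) free_algebra set" and u v
  assume T: "finite T" "T \<subseteq> (\<lambda>w. Poly_Mapping.single w 1) ` W" and v: "v \<in> T"
    and sum: "(\<Sum>t\<in>T. free_module.scale (u t) t) = 0"
  obtain w where w: "v = Poly_Mapping.single w 1"
    using T v by blast
  \<comment> \<open>Distinct members of \<open>T\<close> are distinct words, so reading off the
    coefficient at \<open>w\<close> isolates the summand of \<open>v\<close>.\<close>
  have coeff: "Poly_Mapping.lookup (free_module.scale (u t) t) w = (if t = v then u v else 0)"
    if t: "t \<in> T" for t
  proof -
    obtain w' where w': "t = Poly_Mapping.single w' 1"
      using T t by blast
    have "t = v \<longleftrightarrow> w' = w"
      using injD[OF inj_single_one[where 'b = 'k], of w' w] by (auto simp: w w')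
    then show ?thesis
      by (auto simp: w w' free_module.scale_def mult_single lookup_single when_def)
  qed
  have "0 = (\<Sum>t\<in>T. Poly_Mapping.lookup (free_module.scale (u t) t) w)"
    by (simp add: sum flip: lookup_sum)
  also have "\<dots> = u v"
    using T v by (simp add: coeff)
  finally show "u v = 0"
    by simp
qed

text \<open>The unit generates the free module, and its layers are the words themselves. These are
  independent, so the dimension equals the word count of the free act.\<close>

lemma free_module_growth:
  assumes "CARD('x::finite) > 1"
  shows "right_module.growth ((*) :: ('x, 'k::field) free_algebra \<Rightarrow> _) =
    {f. mono f \<and> growth_equiv f (\<lambda>n. CARD('x) ^ n)}"
proof -
  interpret free: finite_alphabet_module "(*) :: ('x, 'k) free_algebra \<Rightarrow> _"
    by (rule finite_alphabet_module.intro[OF free_module.right_module_axioms])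
  have gen: "free_module.generates {1 :: ('x, 'k) free_algebra}"
    unfolding free_module.generates_def
  proof (intro equalityI subsetI UNIV_I)
    fix a :: "('x, 'k) free_algebra"
    \<comment> \<open>Any submodule containing 1 contains \<open>1 * a\<close>, hence every
      \<open>a\<close>, so the hull of the unit is everything.\<close>
    have "1 * a \<in> N" if "free_module.submodule N" "1 \<in> N" for N
      using that unfolding free_module.submodule_def by blast
    then show "a \<in> free_module.submodule hull {1 :: ('x, 'k) free_algebra}"
      by (auto simp: hull_def)
  qed
  have layer: "free.layer {1 :: ('x, 'k) free_algebra} n = (\<lambda>w. Poly_Mapping.single w 1) ` words_upto n" for n
    by (auto simp: free.layer_def free.word_act_def)
  have eq: "free_module.growth_fun {1 :: ('x, 'k) free_algebra} n = card (words_upto n :: 'x free_monoid set)" for n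
    unfolding free.growth_fun_eq_dim_layer layer
      free_module.vs.dim_eq_card_independent[OF independent_words]
    by (intro card_image inj_on_subset[OF inj_single_one] subset_UNIV)
  have "growth_equiv (free_module.growth_fun {1 :: ('x, 'k) free_algebra}) (\<lambda>n. CARD('x) ^ n)"
    by (rule growth_equiv_powerI[OF assms, where c = "card {1 :: ('x, 'k) free_algebra}"])
      (use free.growth_fun_Suc[of "{1 :: ('x, 'k) free_algebra}"] in \<open>simp_all add: eq power_card_le_card_words_upto\<close>)
  then show ?thesis
    unfolding free.growth_eq[OF _ gen, simplified]
    by (rule growth_class_cong)
qed

lemma (in finite_alphabet_module) maximal_growth_iff:
  assumes "CARD('x) > 1" and "finite A" and "generates A"
  shows "maximal_growth \<longleftrightarrow> growth_equiv (growth_fun A) (\<lambda>n. CARD('x) ^ n)"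
  unfolding maximal_growth_def free_module_growth[OF assms(1)] growth_eq[OF assms(2,3)]
  by (rule growth_class_eq_iff[OF growth_fun_mono[OF assms(2)] mono_power_nat[OF assms(1)]])

theorem lemma5:
  fixes S :: "'s set" and act :: "'s \<Rightarrow> 'x::finite free_monoid \<Rightarrow> 's" and A :: "'s set"
    and mact :: "'m::ab_group_add \<Rightarrow> ('x, 'k::field) free_algebra \<Rightarrow> 'm" and B :: "'m set"
    and r :: nat and \<alpha> \<beta> :: "nat \<Rightarrow> real"
  assumes "r = CARD('x)" and "r > 1"
  shows "(right_act S act \<and> finite A \<and> right_act.generates S act A \<and>
            (\<forall>n. real (right_act.growth_fun act A n) = \<alpha> n * real r ^ n) \<longrightarrow>
          (\<exists>C\<^sub>0. \<alpha> \<longlonglongrightarrow> C\<^sub>0 \<and> (right_act.maximal_growth S act \<longleftrightarrow> C\<^sub>0 > 0))) \<and>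
         (right_module mact \<and> finite B \<and> right_module.generates mact B \<and>
            (\<forall>n. real (right_module.growth_fun mact B n) = \<beta> n * real r ^ n) \<longrightarrow>
          (\<exists>C\<^sub>0. \<beta> \<longlonglongrightarrow> C\<^sub>0 \<and> (right_module.maximal_growth mact \<longleftrightarrow> C\<^sub>0 > 0)))"
proof (intro conjI impI)
  assume *: "right_act S act \<and> finite A \<and> right_act.generates S act A \<and>
    (\<forall>n. real (right_act.growth_fun act A n) = \<alpha> n * real r ^ n)"
  \<comment> \<open>The locale restricts the alphabet type to sort \<open>finite\<close> but adds no
    assumption to \<open>right_act\<close>, so the first conjunct suffices.\<close>
  then interpret finite_alphabet_act S act
    by (intro finite_alphabet_act.intro) (rule conjunct1)
  have A: "finite A" "generates A" and \<alpha>: "\<And>n. real (growth_fun A n) = \<alpha> n * real r ^ n"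
    using * by auto
  have rec: "growth_fun A (Suc n) \<le> r * growth_fun A n + card A" for n
    using growth_fun_Suc A by (simp add: generates_def assms(1))
  obtain C\<^sub>0 where "\<alpha> \<longlonglongrightarrow> C\<^sub>0" "growth_equiv (growth_fun A) (\<lambda>n. r ^ n) \<longleftrightarrow> C\<^sub>0 > 0"
    by (rule growth_coefficient_limit[OF assms(2) rec \<alpha>])
  then show "\<exists>C\<^sub>0. \<alpha> \<longlonglongrightarrow> C\<^sub>0 \<and> (maximal_growth \<longleftrightarrow> C\<^sub>0 > 0)"
    using maximal_growth_iff A assms by auto
next
  assume *: "right_module mact \<and> finite B \<and> right_module.generates mact B \<and>
    (\<forall>n. real (right_module.growth_fun mact B n) = \<beta> n * real r ^ n)"
  then interpret finite_alphabet_module mact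
    by (intro finite_alphabet_module.intro) (rule conjunct1)
  have B: "finite B" "generates B" and \<beta>: "\<And>n. real (growth_fun B n) = \<beta> n * real r ^ n"
    using * by auto
  have rec: "growth_fun B (Suc n) \<le> r * growth_fun B n + card B" for n
    using growth_fun_Suc B by (simp add: assms(1))
  obtain C\<^sub>0 where "\<beta> \<longlonglongrightarrow> C\<^sub>0" "growth_equiv (growth_fun B) (\<lambda>n. r ^ n) \<longleftrightarrow> C\<^sub>0 > 0"
    by (rule growth_coefficient_limit[OF assms(2) rec \<beta>])
  then show "\<exists>C\<^sub>0. \<beta> \<longlonglongrightarrow> C\<^sub>0 \<and> (maximal_growth \<longleftrightarrow> C\<^sub>0 > 0)"
    using maximal_growth_iff B assms by auto
qed

end
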